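(* Let $$A=\lim_{n\to\infty}\frac{1^1 2^2 3^3\cdots n^n}{n^{\frac12 n^2+\frac12 n+\frac1{12}}\,e^{-\frac14 n^2}}$$ be the Glaisher-Kinkelin constant. Then $$\iint_{[0,1]^2}\frac{1-x}{(1+xy)(\ln xy)^2}\,dx\,dy=\ln\frac{\pi^{1/2}A^6}{2^{7/6}e}.$$
   Context: Here $\ln$ is the natural logarithm, $e$ is its base, and $\ln xy$ means $\ln(xy)$. The integrand is defined for $0<x<1$, $0<y<1$, i.e. almost everywhere on the unit square, and the (improper) double integral is taken over the unit square $[0,1]^2$. *)

theory Defs
  imports "HOL-Analysis.Analysis" "HOL-Real_Asymp.Real_Asymp"
begin

definition glaisher_seq :: "nat \<Rightarrow> real" where
  "glaisher_seq n =
     (\<Prod>k=1..n. real k ^ k) /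
     (real n powr (1 / 2 * real n ^ 2 + 1 / 2 * real n + 1 / 12) * exp (- (1 / 4) * real n ^ 2))"

definition glaisher :: real where
  "glaisher = lim glaisher_seq"

text \<open>The limit exists and is positive, so neither \<open>glaisher\<close> nor its logarithm is a junk value.\<close>

lemma glaisher_seq_limit_pos: "\<exists>L>0. glaisher_seq \<longlonglongrightarrow> L"
proof -
  define p where "p = (\<lambda>x::real. 1 / 2 * x ^ 2 + 1 / 2 * x + 1 / 12)"
  define f where "f = (\<lambda>n. (\<Sum>k=1..n. real k * ln (real k)) - p (real n) * ln (real n) + 1 / 4 * real n ^ 2)"
  have ex: "glaisher_seq n = exp (f n)" if "n > 0" for n
  proof -
    have "(\<Prod>k=1..n. real k ^ k) = (\<Prod>k=1..n. exp (real k * ln (real k)))"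
      by (intro prod.cong refl) (simp add: exp_of_nat_mult)
    also have "\<dots> = exp (\<Sum>k=1..n. real k * ln (real k))"
      by (simp add: exp_sum)
    finally have "glaisher_seq n = exp (\<Sum>k=1..n. real k * ln (real k)) /
        (exp (p (real n) * ln (real n)) * exp (- (1 / 4) * real n ^ 2))"
      using that unfolding glaisher_seq_def p_def by (simp add: powr_def)
    also have "\<dots> = exp (f n)"
      unfolding f_def by (simp only: exp_add [symmetric] exp_diff [symmetric]) simp
    finally show ?thesis .
  qed
  have d: "f (Suc n) - f n = (real n + 1) * ln (real n + 1) - p (real n + 1) * ln (real n + 1)
             + p (real n) * ln (real n) + (2 * real n + 1) / 4" for n
    unfolding f_def by (simp add: power2_eq_square field_simps)
  have "(\<lambda>n. f (Suc n) - f n) \<in> O(\<lambda>n. 1 / real n ^ 2)"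
    unfolding d p_def by real_asymp
  moreover have "summable (\<lambda>n. norm (1 / real n ^ 2))"
    using inverse_power_summable[of 2, where ?'a = real] by (simp add: field_simps)
  ultimately have "summable (\<lambda>n. f (Suc n) - f n)"
    by (rule summable_comparison_test_bigo[rotated])
  then have "convergent (\<lambda>n. \<Sum>k<n. f (Suc k) - f k)"
    by (simp add: summable_iff_convergent)
  then obtain c where "(\<lambda>n. f n - f 0) \<longlonglongrightarrow> c"
    by (auto simp: convergent_def sum_lessThan_telescope)
  from tendsto_add[OF this tendsto_const[of "f 0"]] have "f \<longlonglongrightarrow> c + f 0"
    by simp
  then have "(\<lambda>n. exp (f n)) \<longlonglongrightarrow> exp (c + f 0)"
    by (rule tendsto_exp)
  moreover have "eventually (\<lambda>n. exp (f n) = glaisher_seq n) sequentially"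
    using eventually_gt_at_top[of 0] by eventually_elim (simp add: ex)
  ultimately have "glaisher_seq \<longlonglongrightarrow> exp (c + f 0)"
    by (rule Lim_transform_eventually)
  then show ?thesis
    by (intro exI[of _ "exp (c + f 0)"]) simp
qed

lemma glaisher_seq_tendsto: "glaisher_seq \<longlonglongrightarrow> glaisher"
  and glaisher_pos: "glaisher > 0"
  using glaisher_seq_limit_pos unfolding glaisher_def by (auto simp: limI)

end

theory Submission
  imports Defs
begin

text \<open>
  Put \<open>t = x * y\<close>. For \<open>0 < t < 1\<close> both factors of the denominator have reciprocals that expand with
  nonnegative terms:
  \<open>1 / (1 + t) = (\<Sum>j. (1 - t) * t ^ (2 * j))\<close>, the geometric series of ratio \<open>- t\<close> with
  consecutive terms paired, and \<open>1 / (ln t)\<^sup>2\<close> is the integral of \<open>v * t powr v\<close> over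
  \<open>v \<ge> 0\<close>. Since everything is nonnegative, Tonelli's theorem and monotone convergence allow
  the integration over the unit square to be carried out first, where only powers of \<open>x\<close> and
  \<open>y\<close> occur (\<open>nn_integral_unit_square_powr\<close>), then the integration over \<open>v\<close> of a rational
  function (\<open>nn_integral_square_moment\<close>). The double integral becomes the series of
  \<open>F (2 * j + 1) - F (2 * j + 2)\<close> with \<open>F a = (a + 1) * ln ((a + 1) / a) - 1\<close>; this is the
  alternating series of the \<open>F k\<close>, \<open>k \<ge> 1\<close>, summed in pairs.

  The partial sums of this series have a closed form (\<open>alternating_partial_sum\<close>) in which the
  only non-elementary quantities are \<open>8 * H n - 2 * H (2 * n)\<close>, where \<open>H n\<close> is the logarithm of
  \<open>1^1 * 2^2 * \<dots> * n^n\<close>, and half the logarithm of the partial Wallis product. In the limit the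
  former contributes \<open>6 * ln A\<close>, the latter \<open>ln (pi / 2) / 2\<close>, and the elementary remainder
  tends to \<open>- 2 / 3 * ln 2 - 1\<close>.
\<close>

section \<open>The alternating logarithmic series\<close>

text \<open>The logarithm of the hyperfactorial \<open>1^1 * 2^2 * \<dots> * n^n\<close>.\<close>

definition log_hyperfactorial :: "nat \<Rightarrow> real" where
  "log_hyperfactorial n = (\<Sum>k=1..n. real k * ln (real k))"

text \<open>The partial products of Wallis's product for \<open>pi / 2\<close>.\<close>

definition wallis_product :: "nat \<Rightarrow> real" where
  "wallis_product n = (\<Prod>k=1..n. (4 * real k ^ 2) / (4 * real k ^ 2 - 1))"

text \<open>The function \<open>F\<close> whose values at \<open>1, 2, 3, \<dots>\<close>, taken with alternating signs, sum to the
  double integral. It is used for positive arguments only.\<close>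

definition alternating_term :: "real \<Rightarrow> real" where
  "alternating_term a = (a + 1) * ln ((a + 1) / a) - 1"

lemma wallis_product_pos: "wallis_product n > 0"
proof -
  have "4 * real k ^ 2 > 1" if "k \<in> {1..n}" for k
  proof -
    have "real k ^ 2 \<ge> 1" using that by (intro one_le_power) auto
    then show ?thesis by simp
  qed
  then show ?thesis
    unfolding wallis_product_def by (intro prod_pos divide_pos_pos ballI) fastforce+
qed

lemma ln_glaisher_seq:
  assumes "n > 0"
  shows "ln (glaisher_seq n) = log_hyperfactorial n
           - (1 / 2 * real n ^ 2 + 1 / 2 * real n + 1 / 12) * ln (real n) + 1 / 4 * real n ^ 2"
proof -
  have "ln (\<Prod>k=1..n. real k ^ k) = log_hyperfactorial n"
    unfolding log_hyperfactorial_def by (subst ln_prod) (auto simp: ln_realpow)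
  moreover have "(\<Prod>k=1..n. real k ^ k) > 0"
    by (intro prod_pos) auto
  ultimately show ?thesis
    using assms unfolding glaisher_seq_def
    by (simp add: ln_div ln_mult ln_powr)
qed

text \<open>
  The closed form comes from summation by parts: up to the boundary term
  \<open>- (2 * n + 1) * ln (2 * n + 1)\<close>, the coefficient of \<open>ln m\<close> is \<open>(- 1) ^ m * (2 * m + 1)\<close> for
  \<open>m \<le> 2 * n\<close>. Separating even \<open>m\<close> from odd ones expresses the contribution of \<open>2 * m\<close> by
  hyperfactorials and that of \<open>1\<close> by the Wallis product.
\<close>

lemma alternating_partial_sum:
  "(\<Sum>j<n. alternating_term (2 * real j + 1) - alternating_term (2 * real j + 2)) =
     8 * log_hyperfactorial n - 2 * log_hyperfactorial (2 * n) + 4 * real n * (real n + 1) * ln 2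
     + ln (wallis_product n) / 2 - (2 * real n + 1 / 2) * ln (2 * real n + 1)"
proof (induction n)
  case 0
  then show ?case by (simp add: log_hyperfactorial_def wallis_product_def)
next
  case (Suc n)
  have h1: "log_hyperfactorial (Suc n) = log_hyperfactorial n + (real n + 1) * ln (real n + 1)"
    by (simp add: log_hyperfactorial_def add.commute)
  have l: "ln (2 * real n + 2) = ln 2 + ln (real n + 1)"
  proof -
    have "ln (2 * real n + 2) = ln (2 * (real n + 1))" by (simp add: algebra_simps)
    also have "\<dots> = ln 2 + ln (real n + 1)" by (subst ln_mult) auto
    finally show ?thesis .
  qed
  have h2: "log_hyperfactorial (2 * Suc n) = log_hyperfactorial (2 * n)
      + (2 * real n + 1) * ln (2 * real n + 1) + (2 * real n + 2) * (ln 2 + ln (real n + 1))"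
    using l by (simp add: log_hyperfactorial_def add.commute)
  have w: "ln (wallis_product (Suc n)) = ln (wallis_product n)
      + 2 * ln 2 + 2 * ln (real n + 1) - ln (2 * real n + 1) - ln (2 * real n + 3)"
  proof -
    have "wallis_product (Suc n) =
        wallis_product n * ((4 * (real n + 1) ^ 2) / ((2 * real n + 1) * (2 * real n + 3)))"
      by (simp add: wallis_product_def power2_eq_square algebra_simps)
    moreover have "ln (4::real) = 2 * ln 2"
      using ln_realpow[of 2 2] by simp
    ultimately show ?thesis
      using wallis_product_pos[of n]
      by (simp add: ln_mult ln_div ln_realpow)
  qed
  have c1: "alternating_term (2 * real n + 1) =
      (2 * real n + 2) * (ln 2 + ln (real n + 1) - ln (2 * real n + 1)) - 1"
    unfolding alternating_term_def by (simp add: ln_div l add.assoc)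
  have c2: "alternating_term (2 * real n + 2) =
      (2 * real n + 3) * (ln (2 * real n + 3) - ln 2 - ln (real n + 1)) - 1"
    unfolding alternating_term_def by (simp add: ln_div l add.assoc)
  have e: "ln (2 * real (Suc n) + 1) = ln (2 * real n + 3)"
    by (simp add: algebra_simps)
  show ?case
    unfolding sum.lessThan_Suc Suc.IH h1 h2 w c1 c2 e of_nat_Suc
    by (simp add: field_simps)
qed

lemma alternating_term_antimono:
  assumes a: "a > 0"
  shows "alternating_term (a + 1) \<le> alternating_term a"
proof (rule DERIV_nonpos_imp_nonincreasing[where f = alternating_term])
  show "a \<le> a + 1" by simp
  fix b assume "a \<le> b" "b \<le> a + 1"
  with a have b: "b > 0" by simp
  have "(alternating_term has_real_derivative ln ((b + 1) / b) - 1 / b) (at b)"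
    unfolding alternating_term_def using b
    by (auto intro!: derivative_eq_intros simp: divide_simps power2_eq_square)
  moreover have "ln ((b + 1) / b) \<le> 1 / b"
    using b ln_add_one_self_le_self[of "1 / b"] by (simp add: add_divide_distrib)
  ultimately show "\<exists>d. (alternating_term has_real_derivative d) (at b) \<and> d \<le> 0"
    by force
qed

lemma alternating_sums:
  "(\<lambda>j. alternating_term (2 * real j + 1) - alternating_term (2 * real j + 2)) sums
     ln (pi powr (1 / 2) * glaisher ^ 6 / (2 powr (7 / 6) * exp 1))"
proof -
  \<comment> \<open>By the definition of the Glaisher sequence, \<open>log_hyperfactorial n\<close> differs from
    \<open>ln (glaisher_seq n)\<close> by \<open>p n * ln n - n\<^sup>2 / 4\<close>; the elementary part \<open>r\<close> of the partial
    sums collects these corrections.\<close>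
  define p where "p = (\<lambda>x::real. 1 / 2 * x ^ 2 + 1 / 2 * x + 1 / 12)"
  define r where "r = (\<lambda>x::real. 8 * (p x * ln x - 1 / 4 * x ^ 2)
      - 2 * (p (2 * x) * ln (2 * x) - 1 / 4 * (2 * x) ^ 2) + 4 * x * (x + 1) * ln 2
      - (2 * x + 1 / 2) * ln (2 * x + 1))"
  let ?S = "\<lambda>n. 8 * ln (glaisher_seq n) - 2 * ln (glaisher_seq (2 * n))
      + ln (wallis_product n) / 2 + r (real n)"
  have lim_r: "(\<lambda>n. r (real n)) \<longlonglongrightarrow> - 2 / 3 * ln 2 - 1"
    unfolding r_def p_def by real_asymp
  have lim_w: "wallis_product \<longlonglongrightarrow> pi / 2"
    using wallis unfolding wallis_product_def by simp
  have lim_g: "(\<lambda>n. glaisher_seq (2 * n)) \<longlonglongrightarrow> glaisher"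
    by (rule filterlim_compose[OF glaisher_seq_tendsto]) real_asymp
  have "?S \<longlonglongrightarrow> 8 * ln glaisher - 2 * ln glaisher + ln (pi / 2) / 2 + (- 2 / 3 * ln 2 - 1)"
    using glaisher_pos
    by (intro tendsto_intros lim_r lim_w lim_g glaisher_seq_tendsto) auto
  also have "8 * ln glaisher - 2 * ln glaisher + ln (pi / 2) / 2 + (- 2 / 3 * ln 2 - 1) =
      ln (pi powr (1 / 2) * glaisher ^ 6 / (2 powr (7 / 6) * exp 1))"
    using glaisher_pos by (simp add: ln_mult ln_div ln_powr ln_realpow field_simps)
  finally have "?S \<longlonglongrightarrow> \<dots>" .
  moreover have "eventually (\<lambda>n. ?S n =
      (\<Sum>j<n. alternating_term (2 * real j + 1) - alternating_term (2 * real j + 2))) sequentially"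
    using eventually_gt_at_top[of 0]
  proof eventually_elim
    case (elim n)
    then show ?case
      unfolding alternating_partial_sum r_def p_def
      by (simp add: ln_glaisher_seq algebra_simps)
  qed
  ultimately show ?thesis
    unfolding sums_def by (rule Lim_transform_eventually)
qed

section \<open>Integrals of powers over the half-line and the unit square\<close>

lemma nn_integral_inverse_ln_square:
  assumes "0 < t" "t < 1"
  shows "(\<integral>\<^sup>+v. ennreal (v * t powr v) * indicator {0..} v \<partial>lborel) = ennreal (1 / (ln t)\<^sup>2)"
proof -
  define s where "s = - ln t"
  have s: "s > 0" using assms by (simp add: s_def)
  have t: "t powr v = exp (- s * v)" for v
    using assms by (simp add: powr_def s_def mult.commute)
  let ?F = "\<lambda>v. - (v / s + 1 / s\<^sup>2) * exp (- s * v)"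
  have "(\<integral>\<^sup>+v. ennreal (v * exp (- s * v)) * indicator {0..} v \<partial>lborel) = ennreal (0 - ?F 0)"
  proof (rule nn_integral_FTC_atLeast)
    show "DERIV ?F v :> v * exp (- s * v)" for v
      using s by (auto intro!: derivative_eq_intros simp: field_simps power2_eq_square)
    show "(?F \<longlongrightarrow> 0) at_top"
      using s by real_asymp
  qed auto
  then show ?thesis
    by (simp add: t s_def)
qed

text \<open>The integral of \<open>(1 - x) * (x * y) powr a\<close> over the unit square, for \<open>a \<ge> 0\<close>.\<close>

definition square_moment :: "real \<Rightarrow> real" where
  "square_moment a = 1 / ((a + 1)\<^sup>2 * (a + 2))"

lemma nn_integral_unit_square_powr:
  assumes a: "a \<ge> 0"
  shows "(\<integral>\<^sup>+(x, y). indicator ({0..1} \<times> {0..1}) (x, y) *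
            ennreal ((1 - x) * (1 - x * y) * (x * y) powr a) \<partial>lborel)
         = ennreal (square_moment a - square_moment (a + 1))"
proof -
  have pw: "((\<lambda>x::real. x powr b) has_integral 1 / (b + 1)) {0..1}" if "b \<ge> 0" for b
    using has_integral_powr_from_0[of b 1] that by simp
  have powr_Suc: "u powr (b + 1) = u powr b * u" if "u \<ge> 0" for u b :: real
    using that by (cases "u = 0") (auto simp: powr_add)
  define f where "f = (\<lambda>x y::real. (1 - x) * (1 - x * y) * (x * y) powr a)"
  \<comment> \<open>\<open>J x\<close> is the integral of \<open>f x y\<close> over \<open>y\<close>.\<close>
  define J where "J = (\<lambda>x::real. (1 - x) * (x powr a / (a + 1) - x powr (a + 1) / (a + 2)))"
  have f_nonneg: "f x y \<ge> 0" if "x \<in> {0..1}" "y \<in> {0..1}" for x y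
    using that unfolding f_def by (auto intro!: mult_nonneg_nonneg mult_le_one)
  have inner: "(f x has_integral J x) {0..1}" if x: "x \<in> {0..1}" for x
  proof -
    have "((\<lambda>y. (1 - x) * x powr a * y powr a - (1 - x) * x powr (a + 1) * y powr (a + 1)) has_integral
        (1 - x) * x powr a * (1 / (a + 1)) - (1 - x) * x powr (a + 1) * (1 / (a + 1 + 1))) {0..1}"
      using a by (intro has_integral_diff has_integral_mult_right pw) auto
    also have "(1 - x) * x powr a * (1 / (a + 1)) - (1 - x) * x powr (a + 1) * (1 / (a + 1 + 1)) = J x"
      unfolding J_def by (simp add: right_diff_distrib add.assoc)
    finally show ?thesis
    proof (rule has_integral_eq[rotated])
      fix y :: real assume "y \<in> {0..1}"
      then have "x powr (a + 1) = x powr a * x" "y powr (a + 1) = y powr a * y"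
          "(x * y) powr a = x powr a * y powr a"
        using x by (auto simp: powr_Suc powr_mult)
      then show "(1 - x) * x powr a * y powr a - (1 - x) * x powr (a + 1) * y powr (a + 1) = f x y"
        unfolding f_def by (simp add: algebra_simps)
    qed
  qed
  have outer: "(J has_integral (square_moment a - square_moment (a + 1))) {0..1}"
  proof -
    have "((\<lambda>x. x powr a * (1 / (a + 1)) - x powr (a + 1) * (1 / (a + 1) + 1 / (a + 2))
             + x powr (a + 2) * (1 / (a + 2))) has_integral
        1 / (a + 1) * (1 / (a + 1)) - 1 / (a + 1 + 1) * (1 / (a + 1) + 1 / (a + 2))
             + 1 / (a + 2 + 1) * (1 / (a + 2))) {0..1}"
      using a by (intro has_integral_diff has_integral_add has_integral_mult_left pw) auto
    also have "1 / (a + 1) * (1 / (a + 1)) - 1 / (a + 1 + 1) * (1 / (a + 1) + 1 / (a + 2))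
             + 1 / (a + 2 + 1) * (1 / (a + 2)) = square_moment a - square_moment (a + 1)"
    proof -
      have "1 / (p * p) - 1 / (p + 1) * (1 / p + 1 / (p + 1)) + 1 / (p + 2) * (1 / (p + 1))
          = 1 / (p\<^sup>2 * (p + 1)) - 1 / ((p + 1)\<^sup>2 * (p + 2))" if "p > 0" for p :: real
        using that by (simp add: divide_simps power2_eq_square) algebra
      from this[of "a + 1"] a show ?thesis
        by (simp add: square_moment_def add.assoc)
    qed
    finally show ?thesis
    proof (rule has_integral_eq[rotated])
      fix x :: real assume "x \<in> {0..1}"
      then have "x powr (a + 1) = x powr a * x" "x powr (a + 2) = x powr a * x * x"
        using powr_Suc[of x a] powr_Suc[of x "a + 1"] by (auto simp: add.assoc)
      then show "x powr a * (1 / (a + 1)) - x powr (a + 1) * (1 / (a + 1) + 1 / (a + 2))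
             + x powr (a + 2) * (1 / (a + 2)) = J x"
        unfolding J_def by (simp add: algebra_simps add_divide_distrib diff_divide_distrib)
    qed
  qed
  have J_nonneg: "J x \<ge> 0" if "x \<in> {0..1}" for x
    using has_integral_nonneg[OF inner[OF that]] f_nonneg[OF that] by auto
  have "(\<integral>\<^sup>+(x, y). indicator ({0..1} \<times> {0..1}) (x, y) * ennreal (f x y) \<partial>lborel)
      = (\<integral>\<^sup>+z. indicator ({0..1} \<times> {0..1}) z * ennreal (f (fst z) (snd z)) \<partial>(lborel \<Otimes>\<^sub>M lborel))"
    by (simp add: lborel_prod case_prod_unfold)
  also have "\<dots> = (\<integral>\<^sup>+x. \<integral>\<^sup>+y. indicator ({0..1} \<times> {0..1}) (x, y) * ennreal (f x y) \<partial>lborel \<partial>lborel)"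
  proof (subst lborel.nn_integral_fst [symmetric])
    show "(\<lambda>z. indicator ({0..1} \<times> {0..1}) z * ennreal (f (fst z) (snd z)))
        \<in> borel_measurable (lborel \<Otimes>\<^sub>M lborel)"
      unfolding f_def by measurable
  qed simp
  also have "\<dots> = (\<integral>\<^sup>+x. indicator {0..1} x * (\<integral>\<^sup>+y. ennreal (indicator {0..1} y * f x y) \<partial>lborel) \<partial>lborel)"
  proof (intro nn_integral_cong)
    fix x :: real
    show "(\<integral>\<^sup>+y. indicator ({0..1} \<times> {0..1}) (x, y) * ennreal (f x y) \<partial>lborel)
        = indicator {0..1} x * (\<integral>\<^sup>+y. ennreal (indicator {0..1} y * f x y) \<partial>lborel)"
      by (cases "x \<in> {0..1}") (auto simp: indicator_def intro!: nn_integral_cong)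
  qed
  also have "\<dots> = (\<integral>\<^sup>+x. ennreal (indicator {0..1} x * J x) \<partial>lborel)"
  proof (intro nn_integral_cong)
    fix x :: real
    show "indicator {0..1} x * (\<integral>\<^sup>+y. ennreal (indicator {0..1} y * f x y) \<partial>lborel)
        = ennreal (indicator {0..1} x * J x)"
    proof (cases "x \<in> {0..1}")
      case True
      then show ?thesis
        using nn_integral_has_integral_lebesgue[OF f_nonneg[OF True] inner[OF True]] by simp
    qed auto
  qed
  also have "\<dots> = ennreal (square_moment a - square_moment (a + 1))"
    by (rule nn_integral_has_integral_lebesgue[OF J_nonneg outer])
  finally show ?thesis
    unfolding f_def .
qed

lemma square_moment_antimono:
  assumes "0 \<le> a" "a \<le> b"
  shows "square_moment b \<le> square_moment a"
  unfolding square_moment_def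
  using assms by (intro divide_left_mono mult_mono power_mono mult_pos_pos) auto

lemma nn_integral_square_moment:
  fixes a :: real
  assumes a: "a \<ge> 0"
  shows "(\<integral>\<^sup>+v. ennreal (v * (square_moment (a + v) - square_moment (a + v + 1)))
             * indicator {0..} v \<partial>lborel)
         = ennreal (alternating_term (a + 1) - alternating_term (a + 2))"
proof -
  \<comment> \<open>With \<open>w = v + b\<close>, partial fractions turn \<open>v * square_moment (b - 1 + v)\<close>, which is
    \<open>(w - b) / (w\<^sup>2 * (w + 1))\<close>, into \<open>(b + 1) * (1 / w - 1 / (w + 1)) - b / w\<^sup>2\<close>; \<open>G b\<close> is
    the antiderivative vanishing at infinity.\<close>
  define G where "G = (\<lambda>b v::real. (b + 1) * (ln (v + b) - ln (v + b + 1)) + b / (v + b))"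
  have G: "DERIV (G b) v :> v * square_moment (b - 1 + v)" if "b > 0" "v \<ge> 0" for b v
  proof -
    have "DERIV (G b) v :> (b + 1) * (1 / (v + b) - 1 / (v + b + 1)) - b / (v + b)\<^sup>2"
      unfolding G_def using that
      by (auto intro!: derivative_eq_intros simp: power2_eq_square)
    also have "(b + 1) * (1 / (v + b) - 1 / (v + b + 1)) - b / (v + b)\<^sup>2
        = v * square_moment (b - 1 + v)"
    proof -
      have "(b + 1) * (1 / w - 1 / (w + 1)) - b / w\<^sup>2 = (w - b) * (1 / (w\<^sup>2 * (w + 1)))"
        if "w > 0" for w
        using that by (simp add: divide_simps power2_eq_square) algebra
      from this[of "v + b"] that show ?thesis
        by (simp add: square_moment_def algebra_simps)
    qed
    finally show ?thesis .
  qed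
  have G_lim: "(G b \<longlongrightarrow> 0) at_top" for b
    unfolding G_def by real_asymp
  have G_0: "G b 0 = - alternating_term b" if "b > 0" for b
    using that unfolding G_def alternating_term_def by (simp add: ln_div algebra_simps)
  have "(\<integral>\<^sup>+v. ennreal (v * (square_moment (a + v) - square_moment (a + v + 1)))
             * indicator {0..} v \<partial>lborel)
      = ennreal (0 - 0 - (G (a + 1) 0 - G (a + 2) 0))"
  proof (rule nn_integral_FTC_atLeast)
    show "(\<lambda>v. v * (square_moment (a + v) - square_moment (a + v + 1))) \<in> borel_measurable borel"
      unfolding square_moment_def by measurable
    show "DERIV (\<lambda>v. G (a + 1) v - G (a + 2) v) v :>
        v * (square_moment (a + v) - square_moment (a + v + 1))" if "0 \<le> v" for v
      using DERIV_diff[OF G[of "a + 1" v] G[of "a + 2" v]] a that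
      by (simp add: algebra_simps)
    show "0 \<le> v * (square_moment (a + v) - square_moment (a + v + 1))" if "0 \<le> v" for v
      using square_moment_antimono[of "a + v" "a + v + 1"] a that by auto
    show "((\<lambda>v. G (a + 1) v - G (a + 2) v) \<longlongrightarrow> 0 - 0) at_top"
      by (intro tendsto_diff G_lim)
  qed
  then show ?thesis
    using G_0[of "a + 1"] G_0[of "a + 2"] a by simp
qed

section \<open>Expansion of the integrand and the double integral\<close>

text \<open>
  The identity holds on the whole closed square, not only almost everywhere: if \<open>x * y = 0\<close>, the
  left side vanishes because \<open>ln 0 = 0\<close> and division by zero gives \<open>0\<close>, and the right side
  because \<open>0 powr a = 0\<close>; if \<open>x = 1\<close>, both sides contain the factor \<open>1 - x = 0\<close>.
\<close>

lemma integrand_expansion: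
  fixes x y :: real
  assumes "x \<in> {0..1}" "y \<in> {0..1}"
  shows "ennreal ((1 - x) / ((1 + x * y) * (ln (x * y))\<^sup>2)) =
    (\<Sum>j. \<integral>\<^sup>+v. ennreal ((1 - x) * (1 - x * y) * (x * y) powr (2 * real j + v)) *
           (ennreal v * indicator {0..} v) \<partial>lborel)"
proof (cases "x * y = 0 \<or> x = 1")
  case True
  then show ?thesis by auto
next
  case False
  define t where "t = x * y"
  have t: "0 < t" "t < 1"
  proof -
    show "0 < t" using False assms by (auto simp: t_def zero_less_mult_iff)
    have "x * y \<le> x * 1" using assms by (intro mult_left_mono) auto
    also have "x * 1 < 1" using False assms by simp
    finally show "t < 1" by (simp add: t_def)
  qed
  have split: "ennreal ((1 - x) * (1 - t) * t powr (2 * real j + v)) * (ennreal v * indicator {0..} v) =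
      ennreal ((1 - x) * (1 - t) * t ^ (2 * j)) * (ennreal (v * t powr v) * indicator {0..} v)" for j v
    using t assms
    by (auto simp: indicator_def powr_add powr_realpow[symmetric] ennreal_mult[symmetric] mult_ac)
  have "(\<Sum>j. \<integral>\<^sup>+v. ennreal ((1 - x) * (1 - t) * t powr (2 * real j + v)) *
           (ennreal v * indicator {0..} v) \<partial>lborel)
      = (\<Sum>j. ennreal ((1 - x) * (1 - t) * t ^ (2 * j)) * ennreal (1 / (ln t)\<^sup>2))"
    unfolding split using t
    by (simp add: nn_integral_cmult nn_integral_inverse_ln_square)
  also have "\<dots> = (\<Sum>j. ennreal ((1 - x) * (1 - t) / (ln t)\<^sup>2 * (t\<^sup>2) ^ j))"
    using t assms by (simp add: ennreal_mult[symmetric] power_mult)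
  also have "\<dots> = ennreal ((1 - x) * (1 - t) / (ln t)\<^sup>2 * (1 / (1 - t\<^sup>2)))"
  proof (rule suminf_ennreal_eq)
    show "0 \<le> (1 - x) * (1 - t) / (ln t)\<^sup>2 * (t\<^sup>2) ^ j" for j
      using t assms by auto
    show "(\<lambda>j. (1 - x) * (1 - t) / (ln t)\<^sup>2 * (t\<^sup>2) ^ j) sums
        ((1 - x) * (1 - t) / (ln t)\<^sup>2 * (1 / (1 - t\<^sup>2)))"
      using t by (intro sums_mult geometric_sums) (simp add: power_less_one_iff abs_square_less_1)
  qed
  also have "(1 - x) * (1 - t) / (ln t)\<^sup>2 * (1 / (1 - t\<^sup>2)) = (1 - x) / ((1 + t) * (ln t)\<^sup>2)"
  proof -
    have "1 - t\<^sup>2 = (1 - t) * (1 + t)" by (simp add: power2_eq_square algebra_simps)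
    then show ?thesis using t by (simp add: divide_simps)
  qed
  finally show ?thesis
    by (simp add: t_def)
qed

lemma nn_integral_integrand:
  "(\<integral>\<^sup>+(x, y). indicator ({0..1} \<times> {0..1}) (x, y) *
       ennreal ((1 - x) / ((1 + x * y) * (ln (x * y))\<^sup>2)) \<partial>lborel) =
   (\<Sum>j. ennreal (alternating_term (2 * real j + 1) - alternating_term (2 * real j + 2)))"
proof -
  let ?Q = "{0..1} \<times> {0..1} :: (real \<times> real) set"
  let ?k = "\<lambda>a z. indicator ?Q z *
      ennreal ((1 - fst z) * (1 - fst z * snd z) * (fst z * snd z) powr a)"
  have k_meas: "(\<lambda>(z, v). ?k (2 * real j + v) z * (ennreal v * indicator {0..} v))
      \<in> borel_measurable (lborel \<Otimes>\<^sub>M lborel)" for j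
    unfolding split_beta lborel_prod[symmetric] by measurable
  have "(\<integral>\<^sup>+(x, y). indicator ?Q (x, y) * ennreal ((1 - x) / ((1 + x * y) * (ln (x * y))\<^sup>2)) \<partial>lborel)
      = (\<integral>\<^sup>+z. (\<Sum>j. \<integral>\<^sup>+v. ?k (2 * real j + v) z * (ennreal v * indicator {0..} v) \<partial>lborel) \<partial>lborel)"
  proof (intro nn_integral_cong, clarify)
    fix x y :: real
    show "indicator ?Q (x, y) * ennreal ((1 - x) / ((1 + x * y) * (ln (x * y))\<^sup>2)) =
        (\<Sum>j. \<integral>\<^sup>+v. ?k (2 * real j + v) (x, y) * (ennreal v * indicator {0..} v) \<partial>lborel)"
      by (cases "(x, y) \<in> ?Q") (auto simp: integrand_expansion)
  qed
  also have "\<dots> = (\<Sum>j. \<integral>\<^sup>+z. \<integral>\<^sup>+v. ?k (2 * real j + v) z * (ennreal v * indicator {0..} v) \<partial>lborel \<partial>lborel)"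
    using lborel.borel_measurable_nn_integral_fst[OF k_meas]
    by (intro nn_integral_suminf) simp
  also have "\<dots> = (\<Sum>j. \<integral>\<^sup>+v. \<integral>\<^sup>+z. ?k (2 * real j + v) z * (ennreal v * indicator {0..} v) \<partial>lborel \<partial>lborel)"
    by (intro arg_cong[where f = suminf] ext lborel_pair.Fubini'[symmetric] k_meas)
  also have "\<dots> = (\<Sum>j. ennreal (alternating_term (2 * real j + 1) - alternating_term (2 * real j + 2)))"
  proof (intro arg_cong[where f = suminf] ext)
    fix j :: nat
    have "(\<integral>\<^sup>+z. ?k (2 * real j + v) z * (ennreal v * indicator {0..} v) \<partial>lborel) =
        ennreal (v * (square_moment (2 * real j + v) - square_moment (2 * real j + v + 1)))
          * indicator {0..} v" for v
    proof (cases "v \<ge> 0")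
      case True
      have "(\<lambda>z. ?k (2 * real j + v) z) \<in> borel_measurable lborel"
        unfolding lborel_prod[symmetric] by measurable
      then have "(\<integral>\<^sup>+z. ?k (2 * real j + v) z * (ennreal v * indicator {0..} v) \<partial>lborel) =
          (\<integral>\<^sup>+z. ?k (2 * real j + v) z \<partial>lborel) * (ennreal v * indicator {0..} v)"
        by (rule nn_integral_multc)
      also have "(\<integral>\<^sup>+z. ?k (2 * real j + v) z \<partial>lborel) =
          ennreal (square_moment (2 * real j + v) - square_moment (2 * real j + v + 1))"
        using nn_integral_unit_square_powr[of "2 * real j + v"] True
        by (simp add: case_prod_unfold)
      finally show ?thesis
        using True square_moment_antimono[of "2 * real j + v" "2 * real j + v + 1"]
        by (simp add: ennreal_mult[symmetric] mult.commute)
    qed auto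
    then show "(\<integral>\<^sup>+v. \<integral>\<^sup>+z. ?k (2 * real j + v) z * (ennreal v * indicator {0..} v) \<partial>lborel \<partial>lborel)
        = ennreal (alternating_term (2 * real j + 1) - alternating_term (2 * real j + 2))"
      by (simp add: nn_integral_square_moment)
  qed
  finally show ?thesis .
qed

theorem mainTheorem4:
  shows "set_integrable lborel ({0..1} \<times> {0..1})
           (\<lambda>(x::real, y::real). (1 - x) / ((1 + x * y) * (ln (x * y))\<^sup>2)) \<and>
         set_lebesgue_integral lborel ({0..1} \<times> {0..1})
           (\<lambda>(x::real, y::real). (1 - x) / ((1 + x * y) * (ln (x * y))\<^sup>2)) =
         ln (pi powr (1 / 2) * glaisher ^ 6 / (2 powr (7 / 6) * exp 1))"
proof -
  let ?Q = "{0..1} \<times> {0..1} :: (real \<times> real) set"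
  let ?f = "\<lambda>(x::real, y::real). (1 - x) / ((1 + x * y) * (ln (x * y))\<^sup>2)"
  let ?c = "ln (pi powr (1 / 2) * glaisher ^ 6 / (2 powr (7 / 6) * exp 1))"
  have c_nonneg: "0 \<le> alternating_term (2 * real j + 1) - alternating_term (2 * real j + 2)" for j
    using alternating_term_antimono[of "2 * real j + 1"] by (simp add: add.assoc)
  have "has_bochner_integral lborel (\<lambda>z. indicator ?Q z *\<^sub>R ?f z) ?c"
  proof (rule has_bochner_integral_nn_integral)
    show "(\<lambda>z. indicator ?Q z *\<^sub>R ?f z) \<in> borel_measurable lborel"
      unfolding case_prod_unfold lborel_prod[symmetric] by measurable
    show "AE z in lborel. 0 \<le> indicator ?Q z *\<^sub>R ?f z"
      by (auto simp: indicator_def)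
    show "0 \<le> ?c"
      using sums_le[OF c_nonneg sums_zero alternating_sums] .
    have "(\<integral>\<^sup>+z. ennreal (indicator ?Q z *\<^sub>R ?f z) \<partial>lborel) =
        (\<integral>\<^sup>+(x, y). indicator ?Q (x, y) * ennreal (?f (x, y)) \<partial>lborel)"
      by (intro nn_integral_cong) (auto simp: indicator_def)
    also have "\<dots> = ennreal ?c"
      unfolding prod.case nn_integral_integrand
      by (rule suminf_ennreal_eq[OF c_nonneg alternating_sums])
    finally show "(\<integral>\<^sup>+z. ennreal (indicator ?Q z *\<^sub>R ?f z) \<partial>lborel) = ennreal ?c" .
  qed
  then show ?thesis
    unfolding set_integrable_def set_lebesgue_integral_def
    by (simp add: has_bochner_integral_iff)
qed

end
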